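(* Suppose $G$ is a regular directed graph with $N$ vertices whose mixing ratio satisfies $\lambda(G)<1/N^2$. Then for every pair of vertices $u$ and $v$ of $G$, there is an edge from $u$ to $v$.
   Context: Directed graphs may have parallel edges and self-loops. A directed graph is $d$-regular if every vertex has in-degree and out-degree $d$. For a $d$-regular graph on $N$ vertices, the normalized adjacency matrix $M$ has $M_{i,j}$ equal to the number of edges from $j$ to $i$, divided by $d$. With $\vec1=\langle1/N,\dots,1/N\rangle$, the mixing ratio $\lambda(G)$ is the least $\eta\ge0$ such that $\|M\vec v\|\le\eta\|\vec v\|$ for all real vectors $\vec v$ with $\langle\vec v,\vec 1\rangle=0$, where $\|\cdot\|$ is the Euclidean norm. The mixing ratio is defined only for regular graphs. *)

theory Defs
  imports "HOL-Analysis.L2_Norm" "Graph_Theory.Digraph"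
begin

(* The record type pre_digraph admits parallel arcs and self-loops. *)

definition regular_digraph :: "nat \<Rightarrow> ('a, 'b) pre_digraph \<Rightarrow> bool" where
  "regular_digraph d G \<longleftrightarrow> (\<forall>v \<in> verts G. in_degree G v = d \<and> out_degree G v = d)"

(* Row index first: the (i, j) entry counts arcs from j to i.
   Meaningful only for d > 0, since x / 0 = 0 in HOL. *)
definition norm_adj_matrix :: "nat \<Rightarrow> ('a, 'b) pre_digraph \<Rightarrow> 'a \<Rightarrow> 'a \<Rightarrow> real" where
  "norm_adj_matrix d G i j = real (card {e \<in> arcs G. tail G e = j \<and> head G e = i}) / real d"

(* Real vectors indexed by the vertices are functions of which only the values on
   verts G matter. *)
definition mat_vec :: "'a set \<Rightarrow> ('a \<Rightarrow> 'a \<Rightarrow> real) \<Rightarrow> ('a \<Rightarrow> real) \<Rightarrow> 'a \<Rightarrow> real" where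
  "mat_vec V M x i = (\<Sum>j\<in>V. M i j * x j)"

definition inner_on :: "'a set \<Rightarrow> ('a \<Rightarrow> real) \<Rightarrow> ('a \<Rightarrow> real) \<Rightarrow> real" where
  "inner_on V x y = (\<Sum>i\<in>V. x i * y i)"

definition uniform_vec :: "'a set \<Rightarrow> 'a \<Rightarrow> real" where
  "uniform_vec V = (\<lambda>i. 1 / real (card V))"

definition mixing_ratio :: "nat \<Rightarrow> ('a, 'b) pre_digraph \<Rightarrow> real" where
  "mixing_ratio d G =
     (LEAST \<eta>. \<eta> \<ge> 0 \<and>
        (\<forall>x :: 'a \<Rightarrow> real. inner_on (verts G) x (uniform_vec (verts G)) = 0 \<longrightarrow>
           L2_set (mat_vec (verts G) (norm_adj_matrix d G) x) (verts G)
             \<le> \<eta> * L2_set x (verts G)))"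

end

theory Submission
  imports Defs
begin

text \<open>Test the mixing inequality on \<open>x = e\<^sub>u - (1/N, \<dots>, 1/N)\<close>, whose norm is at most \<open>1\<close>. The rows of \<open>M\<close>
  sum to \<open>1\<close>, so if there were no edge from \<open>u\<close> to \<open>v\<close>, the \<open>v\<close>-th entry of \<open>M x\<close> would be \<open>-1/N\<close>,
  forcing the mixing ratio to be at least \<open>1/N \<ge> 1/N\<^sup>2\<close>.\<close>

text \<open>A deliberately crude constant: any finite bound shows that admissible mixing constants
  exist, so that the \<open>LEAST\<close> in \<open>mixing_ratio\<close> is taken over a nonempty
  set.\<close>

lemma L2_set_mat_vec_bound:
  assumes "finite V"
  shows "L2_set (mat_vec V M x) V \<le> (\<Sum>i\<in>V. \<Sum>j\<in>V. \<bar>M i j\<bar>) * L2_set x V"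
proof -
  have "L2_set (mat_vec V M x) V \<le> (\<Sum>i\<in>V. \<bar>mat_vec V M x i\<bar>)"
    by (rule L2_set_le_sum_abs)
  also have "\<dots> \<le> (\<Sum>i\<in>V. \<Sum>j\<in>V. \<bar>M i j\<bar> * L2_set x V)"
  proof (rule sum_mono)
    fix i
    have "\<bar>mat_vec V M x i\<bar> \<le> (\<Sum>j\<in>V. \<bar>M i j\<bar> * \<bar>x j\<bar>)"
      unfolding mat_vec_def abs_mult[symmetric] by (rule sum_abs)
    also have "\<dots> \<le> (\<Sum>j\<in>V. \<bar>M i j\<bar> * L2_set x V)"
    proof (intro sum_mono mult_left_mono)
      fix j assume "j \<in> V"
      then have "\<bar>x j\<bar> \<le> L2_set (\<lambda>j. \<bar>x j\<bar>) V"
        using assms by (intro member_le_L2_set) auto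
      then show "\<bar>x j\<bar> \<le> L2_set x V" by (simp add: L2_set_def)
    qed auto
    finally show "\<bar>mat_vec V M x i\<bar> \<le> (\<Sum>j\<in>V. \<bar>M i j\<bar> * L2_set x V)" .
  qed
  finally show ?thesis by (simp add: sum_distrib_right)
qed

text \<open>\<open>LEAST\<close> over the reals is informative only when a minimum is attained. The
  constant \<open>c\<close> makes the admissible set nonempty, and its infimum is again admissible:
  whenever \<open>P x\<close> and \<open>g x > 0\<close>, the quotient \<open>f x / g x\<close> is a
  lower bound of that set.\<close>

lemma Least_Lipschitz_const:
  fixes f g :: "'a \<Rightarrow> real"
  assumes "\<And>x. g x \<ge> 0" and "c \<ge> 0" and "\<And>x. P x \<Longrightarrow> f x \<le> c * g x"
  defines "Q \<equiv> \<lambda>\<eta>::real. \<eta> \<ge> 0 \<and> (\<forall>x. P x \<longrightarrow> f x \<le> \<eta> * g x)"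
  shows "Q (LEAST \<eta>. Q \<eta>)"
proof -
  define m where "m = Inf (Collect Q)"
  have ne: "Collect Q \<noteq> {}" using assms by auto
  have bdd: "bdd_below (Collect Q)" by (rule bdd_belowI[of _ 0]) (auto simp: Q_def)
  have "m \<ge> 0" unfolding m_def using ne by (rule cInf_greatest) (auto simp: Q_def)
  moreover have "f x \<le> m * g x" if "P x" for x
  proof (cases "g x = 0")
    \<comment> \<open>No quotient is available here, but the bound with \<open>c\<close> already
      forces \<open>f x \<le> 0\<close>.\<close>
    case True
    then show ?thesis using assms(3)[OF that] by simp
  next
    case False
    then have "g x > 0" using assms(1)[of x] by simp
    have "f x / g x \<le> m" unfolding m_def using ne
      by (rule cInf_greatest) (use that \<open>g x > 0\<close> in \<open>auto simp: Q_def divide_le_eq\<close>)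
    then show ?thesis using \<open>g x > 0\<close> by (simp add: divide_le_eq)
  qed
  ultimately have "Q m" by (simp add: Q_def)
  moreover have "m \<le> \<eta>" if "Q \<eta>" for \<eta>
    unfolding m_def using that bdd by (intro cInf_lower) auto
  ultimately have "(LEAST \<eta>. Q \<eta>) = m" by (rule Least_equality)
  with \<open>Q m\<close> show ?thesis by simp
qed

lemma mixing_ratio_bound:
  assumes "finite (verts G)"
  shows mixing_ratio_nonneg: "mixing_ratio d G \<ge> 0"
    and L2_set_mat_vec_le_mixing_ratio:
      "inner_on (verts G) x (uniform_vec (verts G)) = 0 \<Longrightarrow>
        L2_set (mat_vec (verts G) (norm_adj_matrix d G) x) (verts G)
          \<le> mixing_ratio d G * L2_set x (verts G)"
  using Least_Lipschitz_const[where
      P = "\<lambda>x. inner_on (verts G) x (uniform_vec (verts G)) = 0" and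
      f = "\<lambda>x. L2_set (mat_vec (verts G) (norm_adj_matrix d G) x) (verts G)" and
      g = "\<lambda>x. L2_set x (verts G)",
      OF L2_set_nonneg _ L2_set_mat_vec_bound[OF assms]]
  unfolding mixing_ratio_def by (auto simp: sum_nonneg)

text \<open>Row \<open>v\<close> counts the arcs entering \<open>v\<close>, grouped by their tails,
  so it adds up to the in-degree divided by \<open>d\<close>.\<close>

lemma norm_adj_matrix_row_sum:
  assumes "fin_digraph G" and "regular_digraph d G" and "d > 0" and "v \<in> verts G"
  shows "(\<Sum>u\<in>verts G. norm_adj_matrix d G v u) = 1"
proof -
  interpret fin_digraph G by fact
  have "(\<Sum>u\<in>verts G. card {e \<in> arcs G. tail G e = u \<and> head G e = v})
      = (\<Sum>u\<in>verts G. \<Sum>e\<in>{e \<in> in_arcs G v. tail G e = u}. 1)"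
    by (intro sum.cong refl) (auto simp: in_arcs_def intro: arg_cong[where f = card])
  also have "\<dots> = in_degree G v"
    unfolding in_degree_def card_eq_sum
    by (rule sum.group) (auto simp: in_arcs_def)
  also have "\<dots> = d" using assms by (simp add: regular_digraph_def)
  finally show ?thesis
    using \<open>d > 0\<close> unfolding norm_adj_matrix_def
    by (simp flip: sum_divide_distrib of_nat_sum)
qed

lemma norm_adj_matrix_eq_0:
  assumes "\<not> u \<rightarrow>\<^bsub>G\<^esub> v"
  shows "norm_adj_matrix d G v u = 0"
proof -
  have "{e \<in> arcs G. tail G e = u \<and> head G e = v} = {}"
    using assms by (auto simp: arcs_ends_def arc_to_ends_def)
  then show ?thesis by (simp only: norm_adj_matrix_def) simp
qed

lemma mixing_ratio_ge_if_missing_arc: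
  assumes "fin_digraph G" and "regular_digraph d G" and "d > 0"
    and u: "u \<in> verts G" and v: "v \<in> verts G" and "\<not> u \<rightarrow>\<^bsub>G\<^esub> v"
  shows "mixing_ratio d G \<ge> 1 / real (card (verts G))"
proof -
  interpret fin_digraph G by fact
  define N where "N = real (card (verts G))"
  define M where "M = norm_adj_matrix d G"
  define x where "x = (\<lambda>j. (if j = u then 1 else 0) - 1 / N)"
  have "card (verts G) > 0" using u finite_verts by (auto simp: card_gt_0_iff)
  then have N: "N \<ge> 1" unfolding N_def by linarith
  have sum_x: "(\<Sum>j\<in>verts G. x j) = 0"
    using u N by (simp add: x_def sum_subtractf flip: N_def)
  then have "inner_on (verts G) x (uniform_vec (verts G)) = 0"
    by (simp add: inner_on_def uniform_vec_def flip: sum_divide_distrib)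
  note bound = L2_set_mat_vec_le_mixing_ratio[OF finite_verts this, of d]
  \<comment> \<open>Only one factor of the square is expanded: its constant part contributes nothing
    because \<open>x\<close> sums to 0, which leaves \<open>x u\<close>.\<close>
  have "(\<Sum>j\<in>verts G. (x j)\<^sup>2) = (\<Sum>j\<in>verts G. (if j = u then x j else 0) - x j / N)"
    by (intro sum.cong) (auto simp: x_def power2_eq_square algebra_simps diff_divide_distrib)
  also have "\<dots> = 1 - 1 / N"
    using u by (simp add: sum_subtractf sum_x flip: sum_divide_distrib) (simp add: x_def)
  also have "\<dots> \<le> 1" using N by simp
  finally have norm_x: "L2_set x (verts G) \<le> 1" by (simp add: L2_set_def)
  \<comment> \<open>The two parts of \<open>x\<close> give \<open>M v u\<close>, which is 0 without
    an arc, and the row sum of \<open>v\<close> divided by \<open>N\<close>.\<close>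
  have "mat_vec (verts G) M x v
      = (\<Sum>j\<in>verts G. (if j = u then M v j else 0) - M v j / N)"
    unfolding mat_vec_def by (intro sum.cong) (auto simp: x_def algebra_simps)
  also have "\<dots> = - 1 / N"
    using u norm_adj_matrix_eq_0[OF assms(6)] norm_adj_matrix_row_sum[OF assms(1-3) v]
    by (simp add: sum_subtractf M_def flip: sum_divide_distrib)
  finally have "1 / N = \<bar>mat_vec (verts G) M x v\<bar>" using N by simp
  \<comment> \<open>The entry at \<open>v\<close> is negative, so the norm is compared with absolute
    values, which leave it unchanged.\<close>
  also have "\<dots> \<le> L2_set (\<lambda>i. \<bar>mat_vec (verts G) M x i\<bar>) (verts G)"
    using v by (intro member_le_L2_set) auto
  also have "\<dots> \<le> mixing_ratio d G * L2_set x (verts G)"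
    using bound by (simp add: M_def L2_set_def)
  also have "\<dots> \<le> mixing_ratio d G"
    using norm_x mixing_ratio_nonneg[OF finite_verts] by (rule mult_left_le)
  finally show ?thesis by (simp add: N_def)
qed

theorem theorem3p4:
  fixes G :: "('a, 'b) pre_digraph" and d N :: nat
  assumes "fin_digraph G"
    and "card (verts G) = N"
    and "d > 0"
    and "regular_digraph d G"
    and "mixing_ratio d G < 1 / (real N)\<^sup>2"
  shows "\<forall>u \<in> verts G. \<forall>v \<in> verts G. u \<rightarrow>\<^bsub>G\<^esub> v"
proof (intro ballI, rule ccontr)
  fix u v assume "u \<in> verts G" "v \<in> verts G" "\<not> u \<rightarrow>\<^bsub>G\<^esub> v"
  then have "1 / real N \<le> mixing_ratio d G"
    using mixing_ratio_ge_if_missing_arc assms by metis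
  \<comment> \<open>For \<open>N = 0\<close> both sides are 0, as division by 0 gives 0.\<close>
  moreover have "1 / (real N)\<^sup>2 \<le> 1 / real N"
    by (cases "N = 0") (auto simp: power2_eq_square field_simps)
  ultimately show False using assms(5) by linarith
qed

end
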